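(* Let $W>0$, $K^*=2\lceil W\rceil+1$ and $\gamma_{\mathrm{th}}>0$. For $\bar\gamma>0$ let $P_{\mathrm{out}}^{\mathrm{EDoF}}=\left(1-e^{-\gamma_{\mathrm{th}}/\bar\gamma}\right)^{K^*}$. Then the EDoF approximation achieves diversity order $K^*$: $$d^{\mathrm{EDoF}}\triangleq-\lim_{\bar\gamma\to\infty}\frac{\log P_{\mathrm{out}}^{\mathrm{EDoF}}}{\log\bar\gamma}=K^*.$$
   Context: $W$ is the normalized aperture (in wavelengths) of a linear fluid antenna, $\bar\gamma$ is the average SNR, and $\gamma_{\mathrm{th}}$ is the outage threshold. The EDoF (equivalent degrees of freedom) outage approximation models the system as selection combining over $K^*$ i.i.d. unit-mean Rayleigh branches, i.e. it is $P_{\mathrm{out}}^{\mathrm{EDoF}}(x)=(1-e^{-x})^{K^*}$ evaluated at the normalized threshold $x=\gamma_{\mathrm{th}}/\bar\gamma$. *)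

theory Defs
  imports Complex_Main
begin

(* K* = 2 * ceiling W + 1; the conversion to nat loses nothing for W > 0. *)
definition edof_branches :: "real \<Rightarrow> nat" where
  "edof_branches W = nat (2 * \<lceil>W\<rceil> + 1)"

(* Selection combining over K* i.i.d. unit-mean Rayleigh branches;
   x is the normalized threshold, i.e. the outage threshold over the average SNR. *)
definition edof_outage :: "real \<Rightarrow> real \<Rightarrow> real" where
  "edof_outage W x = (1 - exp (- x)) ^ edof_branches W"

(* P maps the average SNR to the outage probability. Lim is an arbitrary value if
   the limit does not exist, so convergence has to be asserted separately. *)
definition diversity_order :: "(real \<Rightarrow> real) \<Rightarrow> real" where
  "diversity_order P = - Lim at_top (\<lambda>\<gamma>. ln (P \<gamma>) / ln \<gamma>)"

end

theory Submission
  imports Defs "HOL-Real_Asymp.Real_Asymp"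
begin

text \<open>Since 1 - exp (-x) ~ x as x tends to 0, a single branch has outage about c / \<gamma>,
  with logarithm ln c - ln \<gamma> + o(1); divided by ln \<gamma> this tends to -1
  (\<open>ln_rayleigh_outage_ratio_tendsto\<close>). The logarithm turns the power into a factor,
  which scales the limit.\<close>

lemma ln_rayleigh_outage_ratio_tendsto:
  fixes c :: real
  assumes "c > 0"
  shows "((\<lambda>\<gamma>. ln (1 - exp (- (c / \<gamma>))) / ln \<gamma>) \<longlongrightarrow> - 1) at_top"
  using assms by real_asymp

theorem theorem1:
  fixes W \<gamma>th :: real
  assumes "W > 0" and "\<gamma>th > 0"
  shows "((\<lambda>\<gamma>. ln (edof_outage W (\<gamma>th / \<gamma>)) / ln \<gamma>) \<longlongrightarrow> - real (edof_branches W)) at_top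
    \<and> diversity_order (\<lambda>\<gamma>. edof_outage W (\<gamma>th / \<gamma>)) = real (edof_branches W)"
proof -
  let ?K = "real (edof_branches W)"
  let ?g = "\<lambda>\<gamma>. ln (edof_outage W (\<gamma>th / \<gamma>)) / ln \<gamma>"
  have "((\<lambda>\<gamma>. ?K * (ln (1 - exp (- (\<gamma>th / \<gamma>))) / ln \<gamma>)) \<longlongrightarrow> ?K * - 1) at_top"
    by (intro tendsto_mult_left ln_rayleigh_outage_ratio_tendsto assms)
  moreover have "\<forall>\<^sub>F \<gamma> in at_top. ?K * (ln (1 - exp (- (\<gamma>th / \<gamma>))) / ln \<gamma>) = ?g \<gamma>"
    \<comment> \<open>For \<gamma> > 0 the base 1 - exp (-(\<gamma>th / \<gamma>)) is positive, as
      \<open>ln_realpow\<close> requires.\<close>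
    using eventually_gt_at_top[of 0]
    by eventually_elim (use assms in \<open>simp add: edof_outage_def ln_realpow\<close>)
  ultimately have lim: "(?g \<longlongrightarrow> - ?K) at_top"
    using Lim_transform_eventually by fastforce
  \<comment> \<open>Limits along the nontrivial filter \<open>at_top\<close> are unique, so
    convergence fixes the value of \<open>Lim\<close>.\<close>
  then have "Lim at_top ?g = - ?K"
    by (intro tendsto_Lim) simp_all
  with lim show ?thesis
    by (simp add: diversity_order_def)
qed

end
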